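(* Let $X$ be a set, let $X'=\{x':x\in X\}$ be a set disjoint from $X$ with $x\mapsto x'$ a bijection $X\to X'$, and let $Y=X\cup X'$. Let $T=\{\alpha\in\mathcal{T}_Y:\ X\alpha=X'\alpha\subseteq X\ \text{or}\ X\alpha=X'\alpha\subseteq X'\}$, and let $R(\mathcal{T}_X)=\{(\lambda,\mu,\alpha)\in\mathcal{T}_X\times\mathcal{T}_X\times R_2:\ X\lambda=X\mu\}$ with the product described in the context. For $\Delta=(\lambda,\mu,\alpha)\in R(\mathcal{T}_X)$ define $\overline{\delta}\in\mathcal{T}_Y$ by: $x\overline{\delta}=x\mu$ and $x'\overline{\delta}=x\lambda$ for all $x\in X$ if $\alpha=\sigma$; and $x\overline{\delta}=(x\mu)'$ and $x'\overline{\delta}=(x\lambda)'$ for all $x\in X$ if $\alpha=\tau$. Then the semibands $R(\mathcal{T}_X)$ and $T$ are isomorphic, and the mapping $\psi:R(\mathcal{T}_X)\to T$, $\Delta\mapsto\overline{\delta}$, is an isomorphism from $R(\mathcal{T}_X)$ onto $T$.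
   Context: $\mathcal{T}_X$ is the full transformation semigroup on $X$; maps are written on the right of their arguments and composed from left to right ($x(\alpha\beta)=(x\alpha)\beta$). A semiband is a semigroup generated by its idempotents; $T$ is a subsemigroup of $\mathcal{T}_Y$, known to be a regular semiband (Higgins). For a regular semigroup $S$, $R(S)$ is the semigroup of triples $(s,t,\alpha)\in S\times S\times R_2$ with $s\,\mathcal{L}\,t$ in $S$, where $\mathcal{L}$ is Green's relation, $R_2=\{\sigma,\tau\}$ is the two-element right-zero semigroup and the product is $(t_1,s_1,\sigma)(t_2,s_2,\alpha_2)=(t_1s_2,\,s_1s_2,\,\alpha_2)$ and $(t_1,s_1,\tau)(t_2,s_2,\alpha_2)=(t_1t_2,\,s_1t_2,\,\alpha_2)$. For $S=\mathcal{T}_X$ one has $\lambda\,\mathcal{L}\,\mu$ if and only if $X\lambda=X\mu$, which gives the description of $R(\mathcal{T}_X)$ in the claim.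
   Formalization: The set X is assumed nonempty; for empty X the claim is false, since R(T_X) then has two elements (the empty maps paired with σ or τ) while T has only one. *)

theory Defs
  imports "HOL-Algebra.Group" "HOL-Library.FuncSet"
begin

text \<open>
  Semigroups are given as HOL-Algebra records, so that the library notions \<open>hom\<close>, \<open>iso\<close> and
  \<open>\<cong>\<close> apply; these use only \<open>carrier\<close> and \<open>mult\<close>. The field \<open>one\<close> has no meaning for
  a structure that is only a semigroup, and nothing below refers to it.
\<close>

definition is_semigroup :: "('s, 'm) monoid_scheme \<Rightarrow> bool" where
  "is_semigroup S \<longleftrightarrow>
     (\<forall>x \<in> carrier S. \<forall>y \<in> carrier S. x \<otimes>\<^bsub>S\<^esub> y \<in> carrier S) \<and>
     (\<forall>x \<in> carrier S. \<forall>y \<in> carrier S. \<forall>z \<in> carrier S.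
        (x \<otimes>\<^bsub>S\<^esub> y) \<otimes>\<^bsub>S\<^esub> z = x \<otimes>\<^bsub>S\<^esub> (y \<otimes>\<^bsub>S\<^esub> z))"

definition idempotents :: "('s, 'm) monoid_scheme \<Rightarrow> 's set" where
  "idempotents S = {e \<in> carrier S. e \<otimes>\<^bsub>S\<^esub> e = e}"

inductive_set subsemigroup_generated :: "('s, 'm) monoid_scheme \<Rightarrow> 's set \<Rightarrow> 's set"
  for S :: "('s, 'm) monoid_scheme" and A :: "'s set" where
  incl: "a \<in> A \<Longrightarrow> a \<in> subsemigroup_generated S A"
| mult: "a \<in> subsemigroup_generated S A \<Longrightarrow> b \<in> subsemigroup_generated S A \<Longrightarrow>
         a \<otimes>\<^bsub>S\<^esub> b \<in> subsemigroup_generated S A"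

definition semiband :: "('s, 'm) monoid_scheme \<Rightarrow> bool" where
  "semiband S \<longleftrightarrow> is_semigroup S \<and> subsemigroup_generated S (idempotents S) = carrier S"

text \<open>
  Self-maps of \<open>X\<close> are extensional functions (\<open>undefined\<close> off \<open>X\<close>), so that equality of
  elements is equality of maps on \<open>X\<close>. Maps act on the right: the product of \<open>\<alpha>\<close> and \<open>\<beta>\<close>
  is \<open>\<alpha>\<close> followed by \<open>\<beta>\<close>, hence the swapped arguments of \<open>compose\<close>.
\<close>

definition full_transformations :: "'a set \<Rightarrow> ('a \<Rightarrow> 'a) monoid" where
  "full_transformations X =
     \<lparr>carrier = X \<rightarrow>\<^sub>E X, mult = (\<lambda>\<alpha> \<beta>. compose X \<beta> \<alpha>), one = (\<lambda>x\<in>X. x)\<rparr>"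

datatype R2 = \<sigma> | \<tau>

text \<open>
  The third component of a product is \<open>a2\<close> because \<open>R2\<close> carries the right-zero multiplication.
\<close>

fun R_mult :: "('s, 'm) monoid_scheme \<Rightarrow> 's \<times> 's \<times> R2 \<Rightarrow> 's \<times> 's \<times> R2 \<Rightarrow> 's \<times> 's \<times> R2" where
  "R_mult S (t1, s1, \<sigma>) (t2, s2, a2) = (t1 \<otimes>\<^bsub>S\<^esub> s2, s1 \<otimes>\<^bsub>S\<^esub> s2, a2)"
| "R_mult S (t1, s1, \<tau>) (t2, s2, a2) = (t1 \<otimes>\<^bsub>S\<^esub> t2, s1 \<otimes>\<^bsub>S\<^esub> t2, a2)"

text \<open>
  For transformations of \<open>X\<close>, Green's relation \<open>\<L>\<close> is equality of images, whence the carrier.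
\<close>

definition R_transformations :: "'a set \<Rightarrow> (('a \<Rightarrow> 'a) \<times> ('a \<Rightarrow> 'a) \<times> R2) monoid" where
  "R_transformations X =
     \<lparr>carrier = {(l, m, a). l \<in> carrier (full_transformations X) \<and>
                            m \<in> carrier (full_transformations X) \<and> l ` X = m ` X},
      mult = R_mult (full_transformations X),
      one = undefined\<rparr>"

definition T_semigroup :: "'a set \<Rightarrow> 'a set \<Rightarrow> ('a \<Rightarrow> 'a) monoid" where
  "T_semigroup X X' =
     (full_transformations (X \<union> X'))
       \<lparr>carrier := {\<alpha> \<in> carrier (full_transformations (X \<union> X')).
                     \<alpha> ` X = \<alpha> ` X' \<and> \<alpha> ` X' \<subseteq> X \<or> \<alpha> ` X = \<alpha> ` X' \<and> \<alpha> ` X' \<subseteq> X'},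
        one := undefined\<rparr>"

text \<open>
  Here \<open>prime\<close> is the bijection \<open>x \<mapsto> x'\<close> from \<open>X\<close> onto \<open>X'\<close>. A point \<open>y\<close> of \<open>X'\<close> is
  \<open>x'\<close> for \<open>x = inv_into X prime y\<close>.
\<close>

fun psi :: "'a set \<Rightarrow> 'a set \<Rightarrow> ('a \<Rightarrow> 'a) \<Rightarrow> ('a \<Rightarrow> 'a) \<times> ('a \<Rightarrow> 'a) \<times> R2 \<Rightarrow> 'a \<Rightarrow> 'a" where
  "psi X X' prime (l, m, \<sigma>) =
     (\<lambda>y \<in> X \<union> X'. if y \<in> X then m y else l (inv_into X prime y))"
| "psi X X' prime (l, m, \<tau>) =
     (\<lambda>y \<in> X \<union> X'. if y \<in> X then prime (m y) else prime (l (inv_into X prime y)))"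

end

theory Submission
  imports Defs
begin

text \<open>
  A triple \<open>(l, m, a)\<close> is a self-map of two copies of \<open>X\<close>: it acts as \<open>m\<close> on the unprimed copy
  and as \<open>l\<close> on the primed copy, and \<open>a\<close> names the copy that receives the common image. When two
  such maps are composed, the copy that the first one lands in decides which of the two branches of
  the second one is applied, and the second one alone decides where the composite lands. These are
  the two clauses of the product of \<open>R(T_X)\<close>, so \<open>psi\<close> is a homomorphism. Its inverse reads \<open>l\<close> and
  \<open>m\<close> off the restrictions to the copies; only the last component needs \<open>X \<noteq> {}\<close>, because an empty
  image lies in both copies.

  The semiband property holds because every triple is a product of two idempotents. The triple
  \<open>(l, m, \<sigma>)\<close> is idempotent when \<open>m\<close> is idempotent, since \<open>l\<close>, having the same image as \<open>m\<close>, is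
  unchanged when followed by \<open>m\<close>; dually for \<open>\<tau>\<close> and \<open>l\<close>. Given \<open>(l, m, \<tau>)\<close>, let \<open>s\<close> be a section
  of \<open>m\<close> over its image \<open>A\<close> and let \<open>e\<close> be an idempotent with image \<open>A\<close>. With maps written
  on the right,
  \<open>(l, m, \<tau>) = (l s, m s, \<sigma>) (e, m, \<tau>)\<close>,
  and both factors are idempotent. Exchanging the roles of \<open>l\<close> and \<open>m\<close> and of the two tags
  factorises \<open>(l, m, \<sigma>)\<close>. The semiband property then passes to \<open>T\<close> along \<open>psi\<close>.
\<close>

section \<open>Semibands and isomorphisms\<close>

lemma subsemigroup_generated_subset_carrier:
  assumes "is_semigroup S" "A \<subseteq> carrier S"
  shows "subsemigroup_generated S A \<subseteq> carrier S"
proof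
  fix x assume "x \<in> subsemigroup_generated S A"
  then show "x \<in> carrier S"
    by induction (use assms in \<open>auto simp: is_semigroup_def\<close>)
qed

lemma semiband_if_idempotents_generate:
  assumes "is_semigroup S" "carrier S \<subseteq> subsemigroup_generated S (idempotents S)"
  shows "semiband S"
  using assms subsemigroup_generated_subset_carrier[of S "idempotents S"]
  by (auto simp: semiband_def idempotents_def)

lemma semiband_iso_image:
  assumes S: "semiband S" and h: "h \<in> iso S T"
  shows "semiband T"
proof -
  have semigroup_S: "is_semigroup S"
    and gen_S: "subsemigroup_generated S (idempotents S) = carrier S"
    using S by (auto simp: semiband_def)
  have closed_S: "a \<otimes>\<^bsub>S\<^esub> b \<in> carrier S" if "a \<in> carrier S" "b \<in> carrier S" for a b
    using semigroup_S that by (auto simp: is_semigroup_def)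
  have h_mult: "h (a \<otimes>\<^bsub>S\<^esub> b) = h a \<otimes>\<^bsub>T\<^esub> h b" if "a \<in> carrier S" "b \<in> carrier S" for a b
    using h that by (simp add: iso_def hom_mult)
  have h_onto: "carrier T = h ` carrier S"
    using h by (simp add: iso_def bij_betw_def)
  have closed_T: "x \<otimes>\<^bsub>T\<^esub> y \<in> carrier T" if "x \<in> carrier T" "y \<in> carrier T" for x y
    using that unfolding h_onto by (auto simp flip: h_mult intro: closed_S)
  have "is_semigroup T"
    unfolding is_semigroup_def
  proof (intro conjI ballI)
    fix x y z assume "x \<in> carrier T" "y \<in> carrier T" "z \<in> carrier T"
    then obtain a b c where "a \<in> carrier S" "b \<in> carrier S" "c \<in> carrier S"
      and "x = h a" "y = h b" "z = h c"
      unfolding h_onto by blast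
    then show "(x \<otimes>\<^bsub>T\<^esub> y) \<otimes>\<^bsub>T\<^esub> z = x \<otimes>\<^bsub>T\<^esub> (y \<otimes>\<^bsub>T\<^esub> z)"
      using semigroup_S by (simp add: closed_S is_semigroup_def flip: h_mult)
  qed (rule closed_T)
  moreover have "h a \<in> subsemigroup_generated T (idempotents T)"
    if "a \<in> subsemigroup_generated S (idempotents S)" for a
    using that
  proof induction
    case (incl a)
    then have "h a \<in> idempotents T"
      using h_onto by (auto simp: idempotents_def simp flip: h_mult)
    then show ?case by (rule subsemigroup_generated.incl)
  next
    case (mult a b)
    then show ?case
      using h_mult gen_S by (simp add: subsemigroup_generated.mult)
  qed
  ultimately show ?thesis
    using gen_S by (intro semiband_if_idempotents_generate) (auto simp: h_onto)
qed

section \<open>Idempotent factorisations in the semigroup of triples\<close>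

lemma mem_carrier_R_transformations:
  "(l, m, a) \<in> carrier (R_transformations X) \<longleftrightarrow>
     l \<in> X \<rightarrow>\<^sub>E X \<and> m \<in> X \<rightarrow>\<^sub>E X \<and> l ` X = m ` X"
  by (simp add: R_transformations_def full_transformations_def)

lemma mult_R_transformations:
  "(l1, m1, a1) \<otimes>\<^bsub>R_transformations X\<^esub> (l2, m2, a2) =
     (let f = (case a1 of \<sigma> \<Rightarrow> m2 | \<tau> \<Rightarrow> l2) in (compose X f l1, compose X f m1, a2))"
  by (cases a1) (simp_all add: R_transformations_def full_transformations_def)

lemma compose_in_extensional_funcset:
  "f \<in> A \<rightarrow>\<^sub>E A \<Longrightarrow> g \<in> A \<rightarrow>\<^sub>E A \<Longrightarrow> compose A g f \<in> A \<rightarrow>\<^sub>E A"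
  by (auto simp: compose_def)

lemma image_compose: "compose A g f ` A = g ` f ` A"
  by (auto simp: compose_def)

lemma is_semigroup_R_transformations: "is_semigroup (R_transformations X)"
  unfolding is_semigroup_def
proof (intro conjI ballI)
  fix p q assume "p \<in> carrier (R_transformations X)" "q \<in> carrier (R_transformations X)"
  then show "p \<otimes>\<^bsub>R_transformations X\<^esub> q \<in> carrier (R_transformations X)"
    by (cases p; cases q)
       (auto simp: mem_carrier_R_transformations mult_R_transformations image_compose
             compose_in_extensional_funcset split: R2.split)
next
  fix p q r assume carrier: "p \<in> carrier (R_transformations X)"
    "q \<in> carrier (R_transformations X)" "r \<in> carrier (R_transformations X)"
  obtain l1 m1 a1 l2 m2 a2 l3 m3 a3
    where pqr: "p = (l1, m1, a1)" "q = (l2, m2, a2)" "r = (l3, m3, a3)"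
    by (metis prod_cases3)
  have assoc: "compose X h (compose X g f) = compose X (compose X h g) f"
    if "f \<in> X \<rightarrow>\<^sub>E X" for f g h :: "'a \<Rightarrow> 'a"
    using that by (auto simp: compose_def fun_eq_iff)
  show "p \<otimes>\<^bsub>R_transformations X\<^esub> q \<otimes>\<^bsub>R_transformations X\<^esub> r =
        p \<otimes>\<^bsub>R_transformations X\<^esub> (q \<otimes>\<^bsub>R_transformations X\<^esub> r)"
    using carrier unfolding pqr
    by (cases a1; cases a2)
       (simp_all add: mem_carrier_R_transformations mult_R_transformations assoc Let_def)
qed

text \<open>
  An idempotent \<open>m\<close> fixes its image pointwise, hence also fixes every value of a map \<open>l\<close> with the
  same image. The hypotheses on \<open>l\<close> and \<open>m\<close> are symmetric, which gives the second part.
\<close>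

lemma idempotent_R_transformations:
  assumes "l \<in> X \<rightarrow>\<^sub>E X" "m \<in> X \<rightarrow>\<^sub>E X" "l ` X = m ` X"
  shows "(\<And>x. x \<in> X \<Longrightarrow> m (m x) = m x) \<Longrightarrow> (l, m, \<sigma>) \<in> idempotents (R_transformations X)"
    and "(\<And>x. x \<in> X \<Longrightarrow> l (l x) = l x) \<Longrightarrow> (l, m, \<tau>) \<in> idempotents (R_transformations X)"
proof -
  have fixed: "compose X f g = g"
    if g: "g \<in> X \<rightarrow>\<^sub>E X" and img: "g ` X = f ` X" and f: "\<And>x. x \<in> X \<Longrightarrow> f (f x) = f x"
    for f g :: "'a \<Rightarrow> 'a"
  proof
    fix x
    show "compose X f g x = g x"
    proof (cases "x \<in> X")
      case True
      then obtain y where "y \<in> X" "g x = f y" using img by blast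
      then show ?thesis using True f by (simp add: compose_def)
    next
      case False
      then show ?thesis by (simp add: compose_def PiE_arb[OF g])
    qed
  qed
  show "(l, m, \<sigma>) \<in> idempotents (R_transformations X)" if m: "\<And>x. x \<in> X \<Longrightarrow> m (m x) = m x"
  proof -
    have "compose X m l = l" "compose X m m = m"
      by (rule fixed; use assms m in simp)+
    then show ?thesis
      using assms by (simp add: idempotents_def mem_carrier_R_transformations mult_R_transformations)
  qed
  show "(l, m, \<tau>) \<in> idempotents (R_transformations X)" if l: "\<And>x. x \<in> X \<Longrightarrow> l (l x) = l x"
  proof -
    have "compose X l l = l" "compose X l m = m"
      by (rule fixed; use assms l in simp)+
    then show ?thesis
      using assms by (simp add: idempotents_def mem_carrier_R_transformations mult_R_transformations)
  qed
qed

text \<open>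
  With \<open>s\<close> a section of \<open>g\<close>, the maps \<open>s \<circ> g\<close> and \<open>s \<circ> f\<close> factor \<open>g\<close> and \<open>f\<close> through \<open>g\<close>; they
  have the common image \<open>s ` g ` X\<close>, a transversal of the kernel of \<open>g\<close>, onto which \<open>s \<circ> g\<close> is a
  retraction. The map \<open>e\<close> retracts \<open>X\<close> onto the image of \<open>g\<close>; off that image \<open>g\<close> itself supplies
  the values.
\<close>

lemma factor_through_common_image:
  assumes f: "f \<in> X \<rightarrow>\<^sub>E X" and g: "g \<in> X \<rightarrow>\<^sub>E X" and img: "f ` X = g ` X"
  obtains p q e where
    "p \<in> X \<rightarrow>\<^sub>E X" "q \<in> X \<rightarrow>\<^sub>E X" "p ` X = q ` X" "\<And>x. x \<in> X \<Longrightarrow> q (q x) = q x"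
    "compose X g p = f" "compose X g q = g"
    "e \<in> X \<rightarrow>\<^sub>E X" "e ` X = g ` X" "\<And>x. x \<in> X \<Longrightarrow> e (e x) = e x"
proof
  define s where "s = inv_into X g"
  define p where "p = compose X s f"
  define q where "q = compose X s g"
  define e where "e = (\<lambda>x\<in>X. if x \<in> g ` X then x else g x)"
  have s_in: "s y \<in> X" and g_s: "g (s y) = y" if "y \<in> g ` X" for y
    using that by (simp_all add: s_def inv_into_into f_inv_into_f)
  have f_in: "f x \<in> g ` X" if "x \<in> X" for x
    using img that by blast
  have g_maps: "g x \<in> X" if "x \<in> X" for x
    using g that by auto
  show "p \<in> X \<rightarrow>\<^sub>E X" "q \<in> X \<rightarrow>\<^sub>E X"
    by (auto simp: p_def q_def compose_def s_in f_in)
  show "p ` X = q ` X"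
    by (simp add: p_def q_def image_compose img)
  show "q (q x) = q x" if "x \<in> X" for x
    using that by (simp add: q_def compose_def s_in g_s)
  show "compose X g p = f" "compose X g q = g"
    using f g by (auto simp: p_def q_def compose_def fun_eq_iff g_s f_in)
  show "e \<in> X \<rightarrow>\<^sub>E X"
    by (auto simp: e_def g_maps)
  show "e ` X = g ` X"
  proof
    show "e ` X \<subseteq> g ` X" by (auto simp: e_def)
    have "y = e y" "y \<in> X" if "y \<in> g ` X" for y
      using that g_maps by (auto simp: e_def)
    then show "g ` X \<subseteq> e ` X" by blast
  qed
  show "e (e x) = e x" if "x \<in> X" for x
    using that g_maps by (auto simp: e_def)
qed

lemma semiband_R_transformations: "semiband (R_transformations X)"
proof -
  let ?R = "R_transformations X"
  have "d \<in> subsemigroup_generated ?R (idempotents ?R)" if "d \<in> carrier ?R" for d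
  proof -
    obtain l m a where d: "d = (l, m, a)" by (metis prod_cases3)
    have lm: "l \<in> X \<rightarrow>\<^sub>E X" "m \<in> X \<rightarrow>\<^sub>E X" "l ` X = m ` X"
      using that by (auto simp: d mem_carrier_R_transformations)
    have "\<exists>u \<in> idempotents ?R. \<exists>v \<in> idempotents ?R. d = u \<otimes>\<^bsub>?R\<^esub> v"
    proof (cases a)
      case \<tau>
      obtain p q e where
        "p \<in> X \<rightarrow>\<^sub>E X" "q \<in> X \<rightarrow>\<^sub>E X" "p ` X = q ` X" "\<And>x. x \<in> X \<Longrightarrow> q (q x) = q x"
        and comp: "compose X m p = l" "compose X m q = m"
        and "e \<in> X \<rightarrow>\<^sub>E X" "e ` X = m ` X" "\<And>x. x \<in> X \<Longrightarrow> e (e x) = e x"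
        using factor_through_common_image[OF lm] by blast
      then have "(p, q, \<sigma>) \<in> idempotents ?R" "(e, m, \<tau>) \<in> idempotents ?R"
        using lm by (simp_all add: idempotent_R_transformations)
      moreover have "d = (p, q, \<sigma>) \<otimes>\<^bsub>?R\<^esub> (e, m, \<tau>)"
        by (simp add: d \<tau> mult_R_transformations comp)
      ultimately show ?thesis by blast
    next
      case \<sigma>
      obtain p q e where
        "p \<in> X \<rightarrow>\<^sub>E X" "q \<in> X \<rightarrow>\<^sub>E X" "p ` X = q ` X" "\<And>x. x \<in> X \<Longrightarrow> q (q x) = q x"
        and comp: "compose X l p = m" "compose X l q = l"
        and "e \<in> X \<rightarrow>\<^sub>E X" "e ` X = l ` X" "\<And>x. x \<in> X \<Longrightarrow> e (e x) = e x"
        using factor_through_common_image[OF lm(2,1) lm(3)[symmetric]] by blast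
      then have "(q, p, \<tau>) \<in> idempotents ?R" "(l, e, \<sigma>) \<in> idempotents ?R"
        using lm by (simp_all add: idempotent_R_transformations)
      moreover have "d = (q, p, \<tau>) \<otimes>\<^bsub>?R\<^esub> (l, e, \<sigma>)"
        by (simp add: d \<sigma> mult_R_transformations comp)
      ultimately show ?thesis by blast
    qed
    then show ?thesis
      by (auto intro: subsemigroup_generated.mult subsemigroup_generated.incl)
  qed
  then show ?thesis
    by (intro semiband_if_idempotents_generate is_semigroup_R_transformations subsetI)
qed

section \<open>Triples as transformations of the doubled set\<close>

definition place :: "('a \<Rightarrow> 'a) \<Rightarrow> R2 \<Rightarrow> 'a \<Rightarrow> 'a" where
  "place prime a x = (case a of \<sigma> \<Rightarrow> x | \<tau> \<Rightarrow> prime x)"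

locale doubled_set =
  fixes X X' :: "'a set" and prime :: "'a \<Rightarrow> 'a"
  assumes disjoint: "X \<inter> X' = {}"
    and prime: "bij_betw prime X X'"
begin

lemma prime_image: "prime ` X = X'"
  using prime by (simp add: bij_betw_def)

lemma prime_in: "x \<in> X \<Longrightarrow> prime x \<in> X'"
  using prime_image by blast

lemma prime_notin: "x \<in> X \<Longrightarrow> prime x \<notin> X"
  using prime_in disjoint by blast

lemma inv_prime: "x \<in> X \<Longrightarrow> inv_into X prime (prime x) = x"
  using prime by (simp add: bij_betw_inv_into_left)

lemma eq_on_doubled_setI:
  assumes "f \<in> extensional (X \<union> X')" "g \<in> extensional (X \<union> X')"
    and "\<And>x. x \<in> X \<Longrightarrow> f x = g x" "\<And>x. x \<in> X \<Longrightarrow> f (prime x) = g (prime x)"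
  shows "f = g"
  using assms(1,2) by (rule extensionalityI) (use assms(3,4) prime_image in auto)

lemma psi_extensional: "psi X X' prime (l, m, a) \<in> extensional (X \<union> X')"
  by (cases a) simp_all

lemma psi_unprimed: "x \<in> X \<Longrightarrow> psi X X' prime (l, m, a) x = place prime a (m x)"
  by (cases a) (simp_all add: place_def)

lemma psi_primed: "x \<in> X \<Longrightarrow> psi X X' prime (l, m, a) (prime x) = place prime a (l x)"
  by (cases a) (simp_all add: place_def prime_in prime_notin inv_prime)

lemma place_inj:
  assumes "x \<in> X" "y \<in> X" "place prime a x = place prime b y"
  shows "a = b" "x = y"
proof -
  show "a = b"
    using assms(3) prime_notin[OF assms(1)] prime_notin[OF assms(2)] assms(1,2)
    by (cases a; cases b) (auto simp: place_def)
  then have "x = y \<or> prime x = prime y"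
    using assms(3) by (cases b) (simp_all add: place_def)
  then show "x = y"
    by (metis inv_prime assms(1,2))
qed

lemma place_image: "place prime a ` X = (case a of \<sigma> \<Rightarrow> X | \<tau> \<Rightarrow> X')"
  by (cases a) (simp_all add: place_def prime_image)

lemma carrier_T_semigroup:
  "\<alpha> \<in> carrier (T_semigroup X X') \<longleftrightarrow>
     \<alpha> \<in> extensional (X \<union> X') \<and> \<alpha> ` X = \<alpha> ` X' \<and> (\<exists>a. \<alpha> ` X \<subseteq> place prime a ` X)"
proof -
  have "(\<exists>a. \<alpha> ` X \<subseteq> place prime a ` X) \<longleftrightarrow> \<alpha> ` X \<subseteq> X \<or> \<alpha> ` X \<subseteq> X'"
  proof
    assume "\<exists>a. \<alpha> ` X \<subseteq> place prime a ` X"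
    then obtain a where "\<alpha> ` X \<subseteq> place prime a ` X" ..
    then show "\<alpha> ` X \<subseteq> X \<or> \<alpha> ` X \<subseteq> X'"
      by (cases a) (simp_all add: place_image)
  next
    assume "\<alpha> ` X \<subseteq> X \<or> \<alpha> ` X \<subseteq> X'"
    then show "\<exists>a. \<alpha> ` X \<subseteq> place prime a ` X"
      using place_image[of \<sigma>] place_image[of \<tau>] by (metis R2.simps(3,4))
  qed
  moreover have "\<alpha> \<in> X \<union> X' \<rightarrow>\<^sub>E X \<union> X' \<longleftrightarrow>
      \<alpha> \<in> extensional (X \<union> X') \<and> \<alpha> ` X \<subseteq> X \<union> X' \<and> \<alpha> ` X' \<subseteq> X \<union> X'"
    by (simp add: PiE_iff image_subset_iff ball_Un conj_commute)
  ultimately show ?thesis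
    unfolding T_semigroup_def full_transformations_def by simp (metis le_supI1 le_supI2)
qed

lemma mult_T_semigroup: "\<alpha> \<otimes>\<^bsub>T_semigroup X X'\<^esub> \<beta> = compose (X \<union> X') \<beta> \<alpha>"
  by (simp add: T_semigroup_def full_transformations_def)

lemma psi_in_carrier:
  assumes "d \<in> carrier (R_transformations X)"
  shows "psi X X' prime d \<in> carrier (T_semigroup X X')"
proof -
  obtain l m a where d: "d = (l, m, a)" by (metis prod_cases3)
  have lm: "l \<in> X \<rightarrow>\<^sub>E X" "m \<in> X \<rightarrow>\<^sub>E X" "l ` X = m ` X"
    using assms by (auto simp: d mem_carrier_R_transformations)
  have unprimed: "psi X X' prime d ` X = place prime a ` m ` X"
    by (simp add: d psi_unprimed image_image)
  have "psi X X' prime d ` prime ` X = place prime a ` l ` X"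
    by (simp add: d psi_primed image_image)
  then have "psi X X' prime d ` X' = place prime a ` l ` X"
    by (simp add: prime_image)
  moreover have "place prime a ` m ` X \<subseteq> place prime a ` X"
    using lm(2) by blast
  ultimately show ?thesis
    unfolding carrier_T_semigroup using unprimed lm(3) psi_extensional d by metis
qed

text \<open>
  The composite enters the branch of the second map that belongs to the copy chosen by \<open>a1\<close>,
  which is the case distinction in the product of triples.
\<close>

lemma psi_mult:
  assumes "d1 \<in> carrier (R_transformations X)" "d2 \<in> carrier (R_transformations X)"
  shows "psi X X' prime (d1 \<otimes>\<^bsub>R_transformations X\<^esub> d2) =
         psi X X' prime d1 \<otimes>\<^bsub>T_semigroup X X'\<^esub> psi X X' prime d2"
proof -
  obtain l1 m1 a1 l2 m2 a2 where d: "d1 = (l1, m1, a1)" "d2 = (l2, m2, a2)"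
    by (metis prod_cases3)
  define f where "f = (case a1 of \<sigma> \<Rightarrow> m2 | \<tau> \<Rightarrow> l2)"
  have maps: "l1 x \<in> X" "m1 x \<in> X" if "x \<in> X" for x
    using assms(1) that by (auto simp: d mem_carrier_R_transformations)
  have branch: "psi X X' prime d2 (place prime a1 x) = place prime a2 (f x)" if "x \<in> X" for x
    using psi_unprimed[OF that, of l2 m2 a2] psi_primed[OF that, of l2 m2 a2]
    by (cases a1) (simp_all add: d f_def place_def)
  have "d1 \<otimes>\<^bsub>R_transformations X\<^esub> d2 = (compose X f l1, compose X f m1, a2)"
    by (simp add: d mult_R_transformations f_def Let_def)
  moreover have "psi X X' prime (compose X f l1, compose X f m1, a2) =
      compose (X \<union> X') (psi X X' prime d2) (psi X X' prime d1)"
    by (rule eq_on_doubled_setI)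
       (simp_all add: psi_extensional psi_unprimed psi_primed compose_def prime_in maps branch d(1)
                 del: psi.simps)
  ultimately show ?thesis
    by (simp add: mult_T_semigroup)
qed

lemma psi_inj:
  assumes "X \<noteq> {}"
  shows "inj_on (psi X X' prime) (carrier (R_transformations X))"
proof (rule inj_onI)
  fix d1 d2
  assume carrier: "d1 \<in> carrier (R_transformations X)" "d2 \<in> carrier (R_transformations X)"
    and eq: "psi X X' prime d1 = psi X X' prime d2"
  obtain l1 m1 a1 l2 m2 a2 where d: "d1 = (l1, m1, a1)" "d2 = (l2, m2, a2)"
    by (metis prod_cases3)
  have ext: "l1 \<in> X \<rightarrow>\<^sub>E X" "m1 \<in> X \<rightarrow>\<^sub>E X" "l2 \<in> X \<rightarrow>\<^sub>E X" "m2 \<in> X \<rightarrow>\<^sub>E X"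
    using carrier by (auto simp: d mem_carrier_R_transformations)
  then have maps: "l1 x \<in> X" "m1 x \<in> X" "l2 x \<in> X" "m2 x \<in> X" if "x \<in> X" for x
    using that by auto
  have m_eq: "place prime a1 (m1 x) = place prime a2 (m2 x)"
    and l_eq: "place prime a1 (l1 x) = place prime a2 (l2 x)" if "x \<in> X" for x
    using psi_unprimed[OF that] psi_primed[OF that] eq unfolding d by metis+
  have "m1 x = m2 x" if "x \<in> X" for x
    using place_inj(2)[OF _ _ m_eq[OF that]] maps[OF that] by blast
  moreover have "l1 x = l2 x" if "x \<in> X" for x
    using place_inj(2)[OF _ _ l_eq[OF that]] maps[OF that] by blast
  moreover have "a1 = a2"
    using assms place_inj(1) m_eq maps by (metis ex_in_conv)
  ultimately show "d1 = d2"
    unfolding d using ext by (auto intro: PiE_ext)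
qed

text \<open>
  Once the receiving copy \<open>a\<close> is known, the components of the preimage are the restrictions of
  \<open>\<alpha>\<close> to the two copies, with all points and values moved back to \<open>X\<close>.
\<close>

lemma psi_surj:
  assumes "\<alpha> \<in> carrier (T_semigroup X X')"
  shows "\<alpha> \<in> psi X X' prime ` carrier (R_transformations X)"
proof -
  obtain a where ext: "\<alpha> \<in> extensional (X \<union> X')"
    and img: "\<alpha> ` X = \<alpha> ` X'" and copy: "\<alpha> ` X \<subseteq> place prime a ` X"
    using assms by (auto simp: carrier_T_semigroup)
  define u where "u = inv_into X (place prime a)"
  define l where "l = (\<lambda>x\<in>X. u (\<alpha> (prime x)))"
  define m where "m = (\<lambda>x\<in>X. u (\<alpha> x))"
  have u_in: "u y \<in> X" and place_u: "place prime a (u y) = y" if "y \<in> \<alpha> ` X" for y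
    using subsetD[OF copy that] by (simp_all add: u_def inv_into_into f_inv_into_f)
  have \<alpha>_prime: "\<alpha> (prime x) \<in> \<alpha> ` X" if "x \<in> X" for x
    using img prime_in[OF that] by blast
  have "l ` X = u ` \<alpha> ` X'" "m ` X = u ` \<alpha> ` X"
    by (auto simp: l_def m_def image_image simp flip: prime_image)
  then have "(l, m, a) \<in> carrier (R_transformations X)"
    using img by (auto simp: mem_carrier_R_transformations l_def m_def u_in \<alpha>_prime)
  moreover have "\<alpha> = psi X X' prime (l, m, a)"
    by (rule eq_on_doubled_setI)
       (simp_all add: ext psi_extensional psi_unprimed psi_primed l_def m_def place_u \<alpha>_prime
                 del: psi.simps)
  ultimately show ?thesis by blast
qed

lemma psi_iso:
  assumes "X \<noteq> {}"
  shows "psi X X' prime \<in> iso (R_transformations X) (T_semigroup X X')"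
proof -
  have "psi X X' prime ` carrier (R_transformations X) = carrier (T_semigroup X X')"
    using psi_in_carrier psi_surj by blast
  then show ?thesis
    using psi_inj[OF assms] psi_in_carrier psi_mult
    by (simp add: iso_def hom_def bij_betw_def)
qed

end

theorem proposition5p7:
  fixes X X' :: "'a set" and prime :: "'a \<Rightarrow> 'a"
  assumes "X \<noteq> {}"
    and "X \<inter> X' = {}"
    and "bij_betw prime X X'"
  shows "semiband (R_transformations X) \<and> semiband (T_semigroup X X') \<and>
         R_transformations X \<cong> T_semigroup X X' \<and>
         psi X X' prime \<in> iso (R_transformations X) (T_semigroup X X')"
proof -
  interpret doubled_set X X' prime
    using assms by unfold_locales
  have iso: "psi X X' prime \<in> iso (R_transformations X) (T_semigroup X X')"
    using assms(1) by (rule psi_iso)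
  show ?thesis
    using semiband_R_transformations[of X] iso semiband_iso_image[OF _ iso] is_isoI[OF iso]
    by simp
qed

end
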